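(* Let $b\ge1$. Then for all $m\ge1$, $0\le n\le bm$ and $k\ge0$, the coefficients of $w^{bm}z^nq^k$ in $$FCFS(bz,w,q)\qquad\text{and}\qquad b\int_0^zU\bigl(bt,\,we^{z-t},\,q\bigr)\,dt$$ coincide; i.e. $FCFS(bz,w,q)=b\int_0^zU(bt,we^{z-t},q)\,dt$ up to terms $w^{bm}z^nq^k$ with $n>bm$.
   Context: Hash tables: $m$ cyclically arranged buckets $1,\dots,m$ of capacity $b$; $n\le bm$ keys labelled $1,\dots,n$ with hash addresses in $\{1,\dots,m\}$, inserted in the order of their labels by linear probing with the first-come-first-served rule: each key is placed in the first non-full bucket among $h(x),h(x)+1,\dots$ (cyclically) and never moved; its displacement is the number of buckets it passes beyond its hash address. $FCFS_{m,n,k}$ is the number of pairs (assignment of hash addresses to the $n$ keys, marked key $\bullet$) such that $\bullet$ has hash address $1$ and displacement $k$; $FCFS(z,w,q)=\sum_{m\ge1}\sum_{n=1}^{bm}\sum_{k\ge0}FCFS_{m,n,k}w^{bm}\frac{z^n}{n!}q^k$. $u_{m,n}(q)$ is the probability generating function of the number of full buckets searched, starting at a given bucket, before reaching a non-full bucket, in a uniformly random table with $m$ buckets and $n$ keys ($n<bm$), and $u_{m,n}(q):=0$ for $n\ge bm$; $U(z,w,q)=\sum_{m\ge1}\sum_{n\ge0}u_{m,n}(q)w^{bm}\frac{(mz)^n}{n!}$. *)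

theory Defs
  imports
    "HOL-Probability.Probability"
    "HOL-Computational_Algebra.Formal_Power_Series"
begin

section \<open>Linear probing with buckets, first come first served\<close>

text \<open>
  The buckets are \<open>1, \<dots>, m\<close>, arranged cyclically; \<open>probe m a i\<close> is the bucket \<open>i\<close> steps
  after bucket \<open>a\<close>.
\<close>

definition probe :: "nat \<Rightarrow> nat \<Rightarrow> nat \<Rightarrow> nat" where
  "probe m a i = (a - 1 + i) mod m + 1"

text \<open>
  A table is represented by its load, the number of keys in each bucket.  The following is
  meaningful only if some bucket is not full; this holds wherever it is used below, namely
  for tables with fewer than \<open>b * m\<close> keys.
\<close>

definition full_searched :: "nat \<Rightarrow> nat \<Rightarrow> (nat \<Rightarrow> nat) \<Rightarrow> nat \<Rightarrow> nat" where
  "full_searched b m L a = (LEAST i. L (probe m a i) < b)"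

primrec load :: "nat \<Rightarrow> nat \<Rightarrow> (nat \<Rightarrow> nat) \<Rightarrow> nat \<Rightarrow> nat \<Rightarrow> nat" where
  "load b m h 0 = (\<lambda>_. 0)"
| "load b m h (Suc n) =
     (let L = load b m h n;
          a = probe m (h (Suc n)) (full_searched b m L (h (Suc n)))
      in L(a := L a + 1))"

text \<open>
  Keys never move, so the displacement of key \<open>x\<close> is determined when it is inserted, into the
  table formed by the keys \<open>1, \<dots>, x - 1\<close>.
\<close>

definition displacement :: "nat \<Rightarrow> nat \<Rightarrow> (nat \<Rightarrow> nat) \<Rightarrow> nat \<Rightarrow> nat" where
  "displacement b m h x = full_searched b m (load b m h (x - 1)) (h x)"

definition hash_assignments :: "nat \<Rightarrow> nat \<Rightarrow> (nat \<Rightarrow> nat) set" where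
  "hash_assignments m n = {1..n} \<rightarrow>\<^sub>E {1..m}"

definition FCFS_count :: "nat \<Rightarrow> nat \<Rightarrow> nat \<Rightarrow> nat \<Rightarrow> nat" where
  "FCFS_count b m n k =
     card {(h, x). h \<in> hash_assignments m n \<and> x \<in> {1..n} \<and> h x = 1 \<and> displacement b m h x = k}"

text \<open>
  The number of full buckets searched in a uniformly random table, starting at bucket \<open>a\<close>.
  Its distribution does not depend on \<open>a\<close>: see \<open>search_pmf_start\<close> below.
\<close>

definition search_pmf :: "nat \<Rightarrow> nat \<Rightarrow> nat \<Rightarrow> nat \<Rightarrow> nat pmf" where
  "search_pmf b m n a =
     map_pmf (\<lambda>h. full_searched b m (load b m h n) a) (pmf_of_set (hash_assignments m n))"

definition u_pgf :: "nat \<Rightarrow> nat \<Rightarrow> nat \<Rightarrow> real fps" where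
  "u_pgf b m n = (if n < b * m then Abs_fps (\<lambda>k. pmf (search_pmf b m n 1) k) else 0)"


section \<open>Generating functions\<close>

text \<open>
  Power series in several variables are iterated power series.  The innermost variable is
  always \<open>q\<close> and the outermost always \<open>w\<close>: the series \<open>FCFS(z,w,q)\<close> and \<open>U(z,w,q)\<close> have type
  \<open>real fps fps fps\<close>, and \<open>coeff_wzq F N n k\<close> is the coefficient of \<open>w^N z^n q^k\<close>.  Series in
  \<open>q, z, t, w\<close> have type \<open>real fps fps fps fps\<close>, with \<open>z\<close> inside \<open>t\<close>.  For \<open>b \<ge> 1\<close> the sums over
  \<open>m\<close> below have at most one term.
\<close>

definition coeff_wzq :: "real fps fps fps \<Rightarrow> nat \<Rightarrow> nat \<Rightarrow> nat \<Rightarrow> real" where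
  "coeff_wzq F N n k = fps_nth (fps_nth (fps_nth F N) n) k"

definition FCFS_gf :: "nat \<Rightarrow> real fps fps fps" where
  "FCFS_gf b =
     Abs_fps (\<lambda>N. \<Sum>m | 1 \<le> m \<and> b * m = N.
       Abs_fps (\<lambda>n. if 1 \<le> n \<and> n \<le> b * m
         then Abs_fps (\<lambda>k. real (FCFS_count b m n k) / fact n) else 0))"

definition U_gf :: "nat \<Rightarrow> real fps fps fps" where
  "U_gf b =
     Abs_fps (\<lambda>N. \<Sum>m | 1 \<le> m \<and> b * m = N.
       Abs_fps (\<lambda>n. fps_const (real m ^ n / fact n) * u_pgf b m n))"

definition map_fps :: "('a \<Rightarrow> 'b) \<Rightarrow> 'a fps \<Rightarrow> 'b fps" where
  "map_fps f F = Abs_fps (\<lambda>n. f (fps_nth F n))"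

text \<open>\<open>F(bz,w,q)\<close>, for \<open>F(z,w,q)\<close>.\<close>

definition scale_z :: "nat \<Rightarrow> real fps fps fps \<Rightarrow> real fps fps fps" where
  "scale_z b F = map_fps (\<lambda>P. P oo (of_nat b * fps_X)) F"

text \<open>
  \<open>F(t,w,q)\<close>, for \<open>F(z,w,q)\<close>: the variable \<open>z\<close> is renamed to \<open>t\<close>, and the coefficients become
  series constant in \<open>z\<close>.
\<close>

definition z_to_t :: "real fps fps fps \<Rightarrow> real fps fps fps fps" where
  "z_to_t F = map_fps (map_fps fps_const) F"

text \<open>\<open>exp (z - t)\<close>, as the product of \<open>exp z\<close> and \<open>exp (- t)\<close>.\<close>

definition exp_z_minus_t :: "real fps fps fps" where
  "exp_z_minus_t =
     fps_const (map_fps fps_const (fps_exp 1)) *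
     map_fps (\<lambda>c. fps_const (fps_const c)) (fps_exp (- 1))"

text \<open>\<open>U(bt, w exp (z - t), q)\<close>; the composition substitutes for the outermost variable \<open>w\<close>.\<close>

definition U_integrand :: "nat \<Rightarrow> real fps fps fps fps" where
  "U_integrand b = z_to_t (scale_z b (U_gf b)) oo (fps_const exp_z_minus_t * fps_X)"

text \<open>\<open>F(z,z,q)\<close>, for \<open>F(z,t,q)\<close>.\<close>

definition t_eq_z :: "real fps fps fps \<Rightarrow> real fps fps" where
  "t_eq_z F = Abs_fps (\<lambda>n. \<Sum>j\<le>n. fps_nth (fps_nth F j) (n - j))"

text \<open>
  The integral over \<open>t\<close> from \<open>0\<close> to \<open>z\<close>, coefficientwise in \<open>w\<close>: the antiderivative in \<open>t\<close> that
  vanishes at \<open>t = 0\<close>, evaluated at \<open>t = z\<close>.  The coefficients \<open>inverse (of_nat n)\<close> in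
  \<open>fps_integral0\<close> are genuine inverses here, as \<open>of_nat n\<close> is a unit in \<open>real fps fps\<close> for \<open>n > 0\<close>.
\<close>

definition integral_0_z :: "real fps fps fps fps \<Rightarrow> real fps fps fps" where
  "integral_0_z F = map_fps (\<lambda>G. t_eq_z (fps_integral0 G)) F"


section \<open>Independence of the starting bucket\<close>

lemma probe_probe: "probe m (probe m a i) j = probe m a (i + j)"
  by (simp add: probe_def mod_add_left_eq add.assoc)

lemma probe_in: "m \<ge> 1 \<Longrightarrow> probe m a i \<in> {1..m}"
  using mod_less_divisor[of m "a - 1 + i"] by (auto simp: probe_def Suc_le_eq)

lemma probe_mult: "a \<in> {1..m} \<Longrightarrow> probe m a (m * i) = a"
  using mod_mult_self2[of "a - 1" m i] by (auto simp: probe_def simp del: mod_mult_self2)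

lemma inj_on_probe: "inj_on (\<lambda>a. probe m a s) {1..m}"
proof (rule inj_on_inverseI)
  fix a assume a: "a \<in> {1..m}"
  then have "s + (m * s - s) = m * s" by (cases m) auto
  then show "probe m (probe m a s) (m * s - s) = a"
    using a by (simp add: probe_probe probe_mult)
qed

lemma full_searched_rotate:
  assumes "m \<ge> 1" and "\<And>j. j \<in> {1..m} \<Longrightarrow> L' (probe m j s) = L j"
  shows "full_searched b m L' (probe m a s) = full_searched b m L a"
proof -
  have "L' (probe m (probe m a s) i) = L (probe m a i)" for i
    using assms(2)[OF probe_in[OF assms(1)], of a i] by (simp add: probe_probe add.commute)
  then show ?thesis by (simp add: full_searched_def)
qed

lemma load_rotate:
  assumes "m \<ge> 1" and "\<And>x. x \<in> {1..n} \<Longrightarrow> h' x = probe m (h x) s" and "j \<in> {1..m}"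
  shows "load b m h' n (probe m j s) = load b m h n j"
  using assms(2,3)
proof (induction n arbitrary: j)
  case (Suc n)
  let ?d = "full_searched b m (load b m h n) (h (Suc n))"
  let ?a = "probe m (h (Suc n)) ?d"
  have IH: "load b m h' n (probe m i s) = load b m h n i" if "i \<in> {1..m}" for i
    using Suc.IH[OF _ that] Suc.prems(1) by simp
  have h': "h' (Suc n) = probe m (h (Suc n)) s" using Suc.prems(1) by simp
  have d: "full_searched b m (load b m h' n) (h' (Suc n)) = ?d"
    unfolding h' using IH by (intro full_searched_rotate[OF assms(1)]) auto
  have a: "probe m (h' (Suc n)) ?d = probe m ?a s"
    by (simp add: h' probe_probe add.commute)
  have eq: "probe m j s = probe m ?a s \<longleftrightarrow> j = ?a"
    using inj_on_probe[of m s] Suc.prems(2) probe_in[OF assms(1)] by (auto dest: inj_onD)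
  show ?case
    using IH[OF Suc.prems(2)] by (auto simp: Let_def d a eq)
qed simp

lemma search_pmf_start:
  assumes m: "m \<ge> 1" and a: "a \<in> {1..m}"
  shows "search_pmf b m n a = search_pmf b m n 1"
proof -
  define s where "s = a - 1"
  have as: "a = probe m 1 s" using a by (auto simp: s_def probe_def)
  define T where "T = (\<lambda>h. restrict (\<lambda>x. probe m (h x) s) {1..n})"
  let ?H = "hash_assignments m n"
  have fin: "finite ?H" and ne: "?H \<noteq> {}"
    using m by (auto simp: hash_assignments_def finite_PiE PiE_eq_empty_iff)
  have "T ` ?H \<subseteq> ?H"
    using probe_in[OF m] by (auto simp: T_def hash_assignments_def)
  moreover have inj: "inj_on T ?H"
  proof (rule inj_onI)
    fix g h assume g: "g \<in> ?H" and h: "h \<in> ?H" and eq: "T g = T h"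
    show "g = h"
    proof (rule PiE_ext)
      show "g \<in> {1..n} \<rightarrow>\<^sub>E {1..m}" "h \<in> {1..n} \<rightarrow>\<^sub>E {1..m}"
        using g h by (simp_all add: hash_assignments_def)
      fix x assume x: "x \<in> {1..n}"
      have "probe m (g x) s = probe m (h x) s"
        using fun_cong[OF eq, of x] x by (simp add: T_def)
      moreover have "g x \<in> {1..m}" "h x \<in> {1..m}"
        using g h x by (auto simp: hash_assignments_def simp del: atLeastAtMost_iff)
      ultimately show "g x = h x" using inj_on_probe[of m s] by (auto dest: inj_onD)
    qed
  qed
  ultimately have bij: "bij_betw T ?H ?H"
    by (simp add: bij_betw_def endo_inj_surj fin)
  have "search_pmf b m n a =
      map_pmf (\<lambda>h. full_searched b m (load b m h n) a) (map_pmf T (pmf_of_set ?H))"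
    by (simp add: search_pmf_def map_pmf_of_set_bij_betw[OF bij ne fin])
  also have "\<dots> = map_pmf (\<lambda>h. full_searched b m (load b m (T h) n) a) (pmf_of_set ?H)"
    by (simp add: pmf.map_comp o_def)
  also have "(\<lambda>h. full_searched b m (load b m (T h) n) a) =
      (\<lambda>h. full_searched b m (load b m h n) 1)"
    unfolding as by (intro ext full_searched_rotate m load_rotate) (auto simp: T_def)
  finally show ?thesis by (simp add: search_pmf_def)
qed

end

theory Submission
  imports Defs
begin

text \<open>
  The displacement of key \<open>x\<close> is the number of full buckets searched in the table formed by the
  keys \<open>1, \<dots>, x - 1\<close>, starting at \<open>h x\<close>.  With \<open>h x = 1\<close> the other \<open>n - 1\<close> addresses are free,
  so \<open>FCFS_count b m n k\<close> is \<open>m ^ (n - 1)\<close> times the sum over \<open>l < n\<close> of the \<open>q^k\<close>-coefficients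
  of \<open>u_pgf b m l\<close>.  On the other side, with \<open>c = b * m\<close>, the integral over \<open>t\<close> from \<open>0\<close> to \<open>z\<close>
  of \<open>t^l / l! * exp (c * (z - t))\<close> has the \<open>z^n\<close>-coefficient \<open>c^(n-1-l) / n!\<close> for \<open>l < n\<close>, by a
  binomial identity.
\<close>

section \<open>Counting hash assignments\<close>

text \<open>Restricting to \<open>S\<close> and to \<open>T\<close> is a bijection onto the pairs of
  functions, and \<open>P\<close> concerns only the first component. It serves to separate the keys
  before the marked key from the remaining ones.\<close>

lemma card_PiE_Un_restrict:
  assumes "S \<inter> T = {}"
  shows "card {h \<in> Pi\<^sub>E (S \<union> T) X. P (restrict h S)} = card {g \<in> Pi\<^sub>E S X. P g} * card (Pi\<^sub>E T X)"
proof -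
  have "bij_betw (\<lambda>h. (restrict h S, restrict h T))
      {h \<in> Pi\<^sub>E (S \<union> T) X. P (restrict h S)} ({g \<in> Pi\<^sub>E S X. P g} \<times> Pi\<^sub>E T X)"
  proof (rule bij_betw_byWitness[where f' = "\<lambda>(g, g') i. if i \<in> S then g i else g' i"])
    show "\<forall>h \<in> {h \<in> Pi\<^sub>E (S \<union> T) X. P (restrict h S)}.
        (\<lambda>(g, g') i. if i \<in> S then g i else g' i) (restrict h S, restrict h T) = h"
      by (auto simp: fun_eq_iff PiE_iff extensional_def)
    have S: "restrict (\<lambda>i. if i \<in> S then g i else g' i) S = g" if "g \<in> Pi\<^sub>E S X" for g g'
      using that by (auto simp: fun_eq_iff PiE_iff extensional_def)
    have T: "restrict (\<lambda>i. if i \<in> S then g i else g' i) T = g'" if "g' \<in> Pi\<^sub>E T X" for g g'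
      using that assms by (auto simp: fun_eq_iff PiE_iff extensional_def)
    show "\<forall>p \<in> {g \<in> Pi\<^sub>E S X. P g} \<times> Pi\<^sub>E T X.
        (\<lambda>h. (restrict h S, restrict h T)) ((\<lambda>(g, g') i. if i \<in> S then g i else g' i) p) = p"
      using S T by auto
    show "(\<lambda>h. (restrict h S, restrict h T)) ` {h \<in> Pi\<^sub>E (S \<union> T) X. P (restrict h S)}
        \<subseteq> {g \<in> Pi\<^sub>E S X. P g} \<times> Pi\<^sub>E T X"
      by (auto simp: PiE_iff)
    show "(\<lambda>(g, g') i. if i \<in> S then g i else g' i) ` ({g \<in> Pi\<^sub>E S X. P g} \<times> Pi\<^sub>E T X)
        \<subseteq> {h \<in> Pi\<^sub>E (S \<union> T) X. P (restrict h S)}"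
      using S by (auto simp: PiE_iff extensional_def)
  qed
  then show ?thesis
    by (simp add: bij_betw_same_card card_cartesian_product)
qed

lemma load_cong:
  "(\<And>x. x \<in> {1..n} \<Longrightarrow> h x = h' x) \<Longrightarrow> load b m h n = load b m h' n"
proof (induction n)
  case (Suc n)
  have "load b m h n = load b m h' n" by (rule Suc.IH) (use Suc.prems in simp)
  then show ?case using Suc.prems[of "Suc n"] by (simp add: Let_def)
qed simp

lemma card_hash_assignments [simp]: "card (hash_assignments m n) = m ^ n"
  by (simp add: hash_assignments_def card_funcsetE)

lemma finite_hash_assignments [simp]: "finite (hash_assignments m n)"
  by (simp add: hash_assignments_def finite_PiE)

text \<open>A probability under the uniform distribution, times the \<open>m ^ n\<close> possible
  assignments.\<close>

lemma card_search:
  assumes "m \<ge> 1" "n < b * m"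
  shows "real (card {g \<in> hash_assignments m n. full_searched b m (load b m g n) 1 = k}) =
    real m ^ n * fps_nth (u_pgf b m n) k"
proof -
  have "hash_assignments m n \<noteq> {}"
    using assms by (auto simp: hash_assignments_def PiE_eq_empty_iff)
  then have "pmf (search_pmf b m n 1) k =
      real (card {g \<in> hash_assignments m n. full_searched b m (load b m g n) 1 = k}) / real m ^ n"
    by (simp add: search_pmf_def pmf_map measure_pmf_of_set vimage_def Int_def)
  with assms show ?thesis by (simp add: u_pgf_def)
qed

text \<open>Only the \<open>x - 1\<close> earlier keys influence the search of key \<open>x\<close>;
  the \<open>n - x\<close> later addresses are arbitrary and contribute the factor
  \<open>m ^ (n - x)\<close>.\<close>

lemma card_marked_displacement:
  assumes "m \<ge> 1" "x \<in> {1..n}" "n \<le> b * m"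
  shows "real (card {h \<in> hash_assignments m n. h x = 1 \<and> displacement b m h x = k}) =
    real m ^ (n - 1) * fps_nth (u_pgf b m (x - 1)) k"
proof -
  \<comment> \<open>The condition \<open>h x = 1\<close> becomes a singleton factor, so the
    admissible assignments form one dependent product.\<close>
  define X where "X = (\<lambda>i. if i = x then {1} else {1..m})"
  define P where "P = (\<lambda>g. full_searched b m (load b m g (x - 1)) 1 = k)"
  have split: "{1..n} = {1..x-1} \<union> {x..n}" using assms(2) by auto
  \<comment> \<open>Even if \<open>n = b * m\<close>, some bucket is not full when key
    \<open>x\<close> arrives, so \<open>u_pgf\<close> does not take its default value 0.\<close>
  have less: "x - 1 < b * m" using assms(2,3) by auto
  have load: "load b m (restrict h {1..x-1}) (x - 1) = load b m h (x - 1)" for h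
    by (rule load_cong) simp
  have "{h \<in> hash_assignments m n. h x = 1 \<and> displacement b m h x = k} =
      {h \<in> Pi\<^sub>E ({1..x-1} \<union> {x..n}) X. P (restrict h {1..x-1})}"
  proof -
    have "h \<in> hash_assignments m n \<and> h x = 1 \<longleftrightarrow> h \<in> Pi\<^sub>E {1..n} X" for h
      using assms(1,2) unfolding hash_assignments_def X_def PiE_iff
      by (metis atLeastAtMost_iff le_refl singletonD singletonI)
    moreover have "displacement b m h x = k \<longleftrightarrow> P (restrict h {1..x-1})" if "h x = 1" for h
      unfolding P_def load displacement_def that ..
    ultimately show ?thesis
      unfolding split[symmetric] by blast
  qed
  then have "card {h \<in> hash_assignments m n. h x = 1 \<and> displacement b m h x = k} =
      card {g \<in> Pi\<^sub>E {1..x-1} X. P g} * card (Pi\<^sub>E {x..n} X)"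
    by (simp only:) (rule card_PiE_Un_restrict, simp)
  also have "Pi\<^sub>E {1..x-1} X = hash_assignments m (x - 1)"
    unfolding hash_assignments_def by (rule PiE_cong) (use assms(2) in \<open>auto simp: X_def\<close>)
  also have "card (Pi\<^sub>E {x..n} X) = m ^ (n - x)"
  proof -
    have "{x..n} = insert x {x<..n}" using assms(2) by auto
    then have "card (Pi\<^sub>E {x..n} X) = card (X x) * (\<Prod>i\<in>{x<..n}. card (X i))"
      by (simp add: card_PiE)
    also have "(\<Prod>i\<in>{x<..n}. card (X i)) = (\<Prod>i\<in>{x<..n}. m)"
      by (rule prod.cong) (auto simp: X_def)
    finally show ?thesis by (simp add: X_def)
  qed
  finally have "real (card {h \<in> hash_assignments m n. h x = 1 \<and> displacement b m h x = k}) =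
      real m ^ (x - 1) * fps_nth (u_pgf b m (x - 1)) k * real m ^ (n - x)"
    using card_search[of m "x - 1" b k, OF assms(1)] less by (simp add: P_def)
  moreover have "real m ^ (n - 1) = real m ^ (x - 1) * real m ^ (n - x)"
    using assms(2) by (simp flip: power_add)
  ultimately show ?thesis by simp
qed

lemma FCFS_count_eq:
  assumes "m \<ge> 1" "n \<le> b * m"
  shows "real (FCFS_count b m n k) = real m ^ (n - 1) * (\<Sum>l<n. fps_nth (u_pgf b m l) k)"
proof -
  let ?A = "\<lambda>x. {h \<in> hash_assignments m n. h x = 1 \<and> displacement b m h x = k}"
  have "FCFS_count b m n k = card ((\<lambda>(x, h). (h, x)) ` (SIGMA x:{1..n}. ?A x))"
    unfolding FCFS_count_def by (rule arg_cong[where f = card]) auto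
  also have "\<dots> = (\<Sum>x\<in>{1..n}. card (?A x))"
    by (subst card_image) (auto simp: inj_on_def)
  finally have "real (FCFS_count b m n k) = (\<Sum>x\<in>{1..n}. real (card (?A x)))"
    by simp
  also have "\<dots> = (\<Sum>x\<in>{1..n}. real m ^ (n - 1) * fps_nth (u_pgf b m (x - 1)) k)"
    using assms by (intro sum.cong refl card_marked_displacement)
  also have "\<dots> = (\<Sum>l<n. real m ^ (n - 1) * fps_nth (u_pgf b m l) k)"
    by (rule sum.reindex_bij_witness[of _ Suc "\<lambda>x. x - 1"]) auto
  finally show ?thesis by (simp add: sum_distrib_left)
qed


section \<open>A binomial identity\<close>

text \<open>Rewriting the product of binomials as
  \<open>(n choose l) * ((n - l) choose (j - l))\<close> leaves an alternating row sum of Pascal's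
  triangle.\<close>

lemma sum_alternating_choose_mult:
  assumes "l \<le> n"
  shows "(\<Sum>j=l..n. (-1) ^ (j - l) * real ((n choose j) * (j choose l))) = (if n = l then 1 else 0)"
proof -
  have "(\<Sum>j=l..n. (-1) ^ (j - l) * real ((n choose j) * (j choose l))) =
      (\<Sum>i\<le>n-l. (-1) ^ i * real ((n choose l) * ((n - l) choose i)))"
    by (rule sum.reindex_bij_witness[of _ "\<lambda>i. i + l" "\<lambda>j. j - l"])
       (use assms in \<open>auto simp: choose_mult\<close>)
  also have "\<dots> = real (n choose l) * (\<Sum>i\<le>n-l. (-1) ^ i * real ((n - l) choose i))"
    by (simp add: sum_distrib_left mult_ac)
  also have "\<dots> = (if n = l then 1 else 0)"
    using choose_alternating_sum[of "n - l", where 'a = real] assms by auto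
  finally show ?thesis .
qed

text \<open>Pascal's rule for \<open>Suc n choose Suc j\<close> splits the sum into the one of the
  preceding lemma and the one for \<open>n\<close>. Exactly one of them is 1: the former if
  \<open>n = l\<close>, the latter, by induction, if \<open>l < n\<close>.\<close>

lemma sum_alternating_choose_Suc_mult:
  "l < n \<Longrightarrow> (\<Sum>j=l..<n. (-1) ^ (j - l) * real ((n choose Suc j) * (j choose l))) = 1"
proof (induction n)
  case (Suc n)
  let ?f = "\<lambda>n j. (-1) ^ (j - l) * real ((n choose Suc j) * (j choose l))"
  have "(\<Sum>j=l..<Suc n. ?f (Suc n) j) =
      (\<Sum>j=l..n. (-1) ^ (j - l) * real ((n choose j) * (j choose l))) + (\<Sum>j=l..n. ?f n j)"
    by (simp add: atLeastLessThanSuc_atLeastAtMost ring_distribs flip: sum.distrib)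
  \<comment> \<open>The term \<open>j = n\<close> vanishes, since \<open>n choose Suc n\<close> is
    0.\<close>
  also have "(\<Sum>j=l..n. ?f n j) = (\<Sum>j=l..<n. ?f n j)"
    by (rule sum.mono_neutral_right) (auto simp: not_less)
  also have "\<dots> = (if n = l then 0 else 1)"
    using Suc by auto
  finally show ?case using sum_alternating_choose_mult[of l n] Suc.prems by simp
qed simp

text \<open>This is the Beta integral of \<open>t^l * (1 - t)^(n-1-l)\<close> over [0,1], divided by
  \<open>l! * (n-1-l)!\<close>, with the power of \<open>1 - t\<close> expanded and integrated
  termwise.\<close>

lemma beta_sum:
  assumes "l < n"
  shows "(\<Sum>j=l..<n. (-1) ^ (j - l) / (real (Suc j) * fact (n - Suc j) * fact (j - l) * fact l)) =
    1 / fact n"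
proof -
  have "(-1) ^ (j - l) / (real (Suc j) * fact (n - Suc j) * fact (j - l) * fact l) =
      (-1) ^ (j - l) * real ((n choose Suc j) * (j choose l)) / fact n" if "j \<in> {l..<n}" for j
    using that by (simp add: binomial_fact divide_simps del: of_nat_Suc)
  then show ?thesis
    using sum_alternating_choose_Suc_mult[OF assms] by (simp flip: sum_divide_distrib)
qed


section \<open>Coefficients of the generating functions\<close>

lemma map_fps_nth [simp]: "fps_nth (map_fps f F) n = f (fps_nth F n)"
  by (simp add: map_fps_def)

text \<open>A ring homomorphism applied to the coefficients respects Cauchy products. This moves
  powers inside the two factors of \<open>exp_z_minus_t\<close>.\<close>

lemma map_fps_power:
  fixes f :: "'a::comm_ring_1 \<Rightarrow> 'b::comm_ring_1"
  assumes "f 0 = 0" "f 1 = 1" "\<And>x y. f (x + y) = f x + f y" "\<And>x y. f (x * y) = f x * f y"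
  shows "map_fps f F ^ n = map_fps f (F ^ n)"
proof (induction n)
  case 0
  show ?case using assms by (auto simp: fps_eq_iff)
next
  case (Suc n)
  have "f (sum g A) = (\<Sum>x\<in>A. f (g x))" for g :: "nat \<Rightarrow> 'a" and A
    using assms(1,3) sum_comp_morphism[of f g A] by (simp add: o_def)
  then show ?case using Suc assms(4) by (simp add: fps_eq_iff fps_mult_nth)
qed

text \<open>The power is \<open>exp (N * z) * exp (- N * t)\<close>; here \<open>i\<close> is the
  exponent of \<open>t\<close>, and the coefficient is a series in \<open>z\<close>.\<close>

lemma exp_z_minus_t_power_nth:
  "fps_nth (exp_z_minus_t ^ N) i =
    map_fps fps_const (fps_exp (real N)) * fps_const (fps_const ((- real N) ^ i / fact i))"
  by (simp add: exp_z_minus_t_def power_mult_distrib map_fps_power fps_exp_power_mult)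

lemma scale_z_nth: "fps_nth (fps_nth (scale_z b F) N) n = of_nat b ^ n * fps_nth (fps_nth F N) n"
  by (simp add: scale_z_def flip: fps_of_nat del: fps_const_power)

lemma U_gf_nth:
  assumes "b \<ge> 1" "m \<ge> 1"
  shows "fps_nth (fps_nth (U_gf b) (b * m)) n = fps_const (real m ^ n / fact n) * u_pgf b m n"
proof -
  have "{m'. 1 \<le> m' \<and> b * m' = b * m} = {m}" using assms by auto
  then show ?thesis by (simp add: U_gf_def)
qed

lemma FCFS_gf_nth:
  assumes "b \<ge> 1" "m \<ge> 1"
  shows "coeff_wzq (FCFS_gf b) (b * m) n k =
    (if 1 \<le> n \<and> n \<le> b * m then real (FCFS_count b m n k) / fact n else 0)"
proof -
  have "{m'. 1 \<le> m' \<and> b * m' = b * m} = {m}" using assms by auto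
  then show ?thesis
    by (simp only: FCFS_gf_def coeff_wzq_def fps_nth_Abs_fps) simp
qed

lemma coeff_scale_z: "coeff_wzq (scale_z b F) N n k = real b ^ n * coeff_wzq F N n k"
  by (simp add: coeff_wzq_def scale_z_nth flip: of_nat_power)

text \<open>Substituting \<open>C * w\<close> for \<open>w\<close> multiplies the coefficient of
  \<open>w^N\<close> by \<open>C^N\<close>.\<close>

lemma U_integrand_nth:
  "fps_nth (U_integrand b) N = exp_z_minus_t ^ N * fps_nth (z_to_t (scale_z b (U_gf b))) N"
  by (simp add: U_integrand_def)

text \<open>The indices \<open>j\<close>, \<open>i\<close>, \<open>k\<close> are the exponents of
  \<open>t\<close>, \<open>z\<close>, \<open>q\<close>. The sum is the Cauchy product in
  \<open>t\<close> of \<open>exp (- b * m * t)\<close> with the coefficient of \<open>U\<close>,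
  where \<open>b ^ l\<close> from the scaling joins \<open>m ^ l\<close>.\<close>

lemma coeff_U_integrand:
  assumes "b \<ge> 1" "m \<ge> 1"
  shows "fps_nth (fps_nth (fps_nth (fps_nth (U_integrand b) (b * m)) j) i) k =
    (\<Sum>l\<le>j. real (b * m) ^ i / fact i * (- real (b * m)) ^ (j - l) / fact (j - l) *
      real (b * m) ^ l / fact l * fps_nth (u_pgf b m l) k)"
proof -
  have "fps_nth (fps_nth (fps_nth (fps_nth (U_integrand b) (b * m)) j) i) k =
     (\<Sum>s\<le>j. real (b * m) ^ i / fact i * (- real (b * m)) ^ s / fact s *
      real (b * m) ^ (j - s) / fact (j - s) * fps_nth (u_pgf b m (j - s)) k)"
    by (simp add: U_integrand_nth fps_mult_nth[of "exp_z_minus_t ^ _"] fps_sum_nth atLeast0AtMost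
        exp_z_minus_t_power_nth z_to_t_def scale_z_nth U_gf_nth[OF assms] mult.assoc
        power_mult_distrib flip: of_nat_power)
  also have "\<dots> = (\<Sum>l\<le>j. real (b * m) ^ i / fact i * (- real (b * m)) ^ (j - l) / fact (j - l) *
      real (b * m) ^ l / fact l * fps_nth (u_pgf b m l) k)"
    by (rule sum.reindex_bij_witness[of _ "\<lambda>l. j - l" "\<lambda>l. j - l"]) auto
  finally show ?thesis .
qed

text \<open>Integration turns \<open>t^j\<close> into \<open>t^(j+1) / (j+1)\<close>, so after
  setting \<open>t = z\<close> the exponent left for \<open>z\<close> is
  \<open>n - Suc j\<close>.\<close>

lemma coeff_integral_0_z:
  "coeff_wzq (integral_0_z F) N n k =
    (\<Sum>j<n. fps_nth (fps_nth (fps_nth (fps_nth F N) j) (n - Suc j)) k / real (Suc j))"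
proof -
  let ?G = "fps_integral0 (fps_nth F N)"
  have nth: "fps_nth (fps_nth (fps_nth ?G (Suc j)) i) k =
      fps_nth (fps_nth (fps_nth (fps_nth F N) j) i) k / real (Suc j)" for i j
    by (simp only: fps_integral_nth_0_Suc inverse_fps_of_nat fps_mult_left_const_nth)
       (simp add: field_simps)
  have "coeff_wzq (integral_0_z F) N n k =
      (\<Sum>j\<in>{..<Suc n}. fps_nth (fps_nth (fps_nth ?G j) (n - j)) k)"
    by (simp add: coeff_wzq_def integral_0_z_def t_eq_z_def fps_sum_nth lessThan_Suc_atMost)
  \<comment> \<open>The term \<open>j = 0\<close> drops out because the antiderivative vanishes at
    \<open>t = 0\<close>.\<close>
  also have "\<dots> = (\<Sum>j<n. fps_nth (fps_nth (fps_nth ?G (Suc j)) (n - Suc j)) k)"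
    by (subst sum.lessThan_Suc_shift) simp
  finally show ?thesis by (simp only: nth)
qed

lemma coeff_integral_U:
  assumes "b \<ge> 1" "m \<ge> 1"
  shows "coeff_wzq (integral_0_z (U_integrand b)) (b * m) n k =
    real (b * m) ^ (n - 1) / fact n * (\<Sum>l<n. fps_nth (u_pgf b m l) k)"
proof -
  let ?u = "\<lambda>l. fps_nth (u_pgf b m l) k"
  let ?c = "real (b * m)"
  let ?f = "\<lambda>l j. (-1) ^ (j - l) / (real (Suc j) * fact (n - Suc j) * fact (j - l) * fact l)"
  \<comment> \<open>The exponents always add up to \<open>n - 1\<close>, so all powers of
    \<open>?c\<close> leave the double sum.\<close>
  have pow: "?c ^ (n - 1) = ?c ^ (n - Suc j) * (?c ^ (j - l) * ?c ^ l)" if "j < n" "l \<le> j" for j l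
    using that by (simp flip: power_add)
  have "coeff_wzq (integral_0_z (U_integrand b)) (b * m) n k =
      (\<Sum>j<n. \<Sum>l\<le>j. ?c ^ (n - 1) * ?u l * ?f l j)"
    unfolding coeff_integral_0_z coeff_U_integrand[OF assms] sum_divide_distrib
  proof (intro sum.cong refl)
    fix j l assume jl: "j \<in> {..<n}" "l \<in> {..j}"
    show "?c ^ (n - Suc j) / fact (n - Suc j) * (- ?c) ^ (j - l) / fact (j - l) *
        ?c ^ l / fact l * ?u l / real (Suc j) = ?c ^ (n - 1) * ?u l * ?f l j"
      using jl by (subst pow[of j l]) (simp_all add: power_minus[of ?c] field_simps del: of_nat_mult of_nat_Suc)
  qed
  \<comment> \<open>Summing over \<open>j\<close> first, for fixed \<open>l\<close>, produces the
    sum of \<open>beta_sum\<close>.\<close>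
  also have "\<dots> = (\<Sum>l<n. \<Sum>j=l..<n. ?c ^ (n - 1) * ?u l * ?f l j)"
    unfolding sum.Sigma[OF finite_lessThan ballI[OF finite_atMost]]
      sum.Sigma[OF finite_lessThan ballI[OF finite_atLeastLessThan]]
    by (rule sum.reindex_bij_witness[of _ prod.swap prod.swap]) auto
  also have "\<dots> = (\<Sum>l<n. ?c ^ (n - 1) * ?u l * (1 / fact n))"
    by (intro sum.cong refl) (simp only: beta_sum lessThan_iff flip: sum_distrib_left)
  also have "\<dots> = ?c ^ (n - 1) / fact n * (\<Sum>l<n. ?u l)"
    unfolding sum_distrib_left by (intro sum.cong refl) simp
  finally show ?thesis .
qed

section \<open>Comparison of the two series\<close>

lemma coeff_of_nat_mult: "coeff_wzq (of_nat a * F) N n k = real a * coeff_wzq F N n k"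
  by (simp add: coeff_wzq_def)

lemma coeff_FCFS_eq_integral_U:
  assumes "b \<ge> 1" "m \<ge> 1" "n \<le> b * m"
  shows "coeff_wzq (scale_z b (FCFS_gf b)) (b * m) n k =
    coeff_wzq (of_nat b * integral_0_z (U_integrand b)) (b * m) n k"
\<comment> \<open>For \<open>n > 0\<close> the claim reduces to
  \<open>b ^ n * m ^ (n - 1) = b * (b * m) ^ (n - 1)\<close>. This fails for \<open>n = 0\<close>
  under truncated subtraction, but there both coefficients are 0.\<close>
proof (cases n)
  case 0
  then show ?thesis
    using assms by (simp add: coeff_scale_z FCFS_gf_nth coeff_of_nat_mult coeff_integral_U)
next
  case (Suc n')
  then show ?thesis
    using assms
    by (simp add: coeff_scale_z FCFS_gf_nth coeff_of_nat_mult coeff_integral_U FCFS_count_eq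
        power_mult_distrib)
qed

theorem theorem12p1:
  fixes b :: nat
  assumes "b \<ge> 1"
  shows "(\<forall>m n k. 1 \<le> m \<longrightarrow> n \<le> b * m \<longrightarrow>
            coeff_wzq (scale_z b (FCFS_gf b)) (b * m) n k =
            coeff_wzq (of_nat b * integral_0_z (U_integrand b)) (b * m) n k) \<and>
         (\<forall>N n k. \<not> (\<exists>m. 1 \<le> m \<and> N = b * m \<and> b * m < n) \<longrightarrow>
            coeff_wzq (scale_z b (FCFS_gf b)) N n k =
            coeff_wzq (of_nat b * integral_0_z (U_integrand b)) N n k)"
proof (intro conjI allI impI)
  fix m n k :: nat assume "1 \<le> m" "n \<le> b * m"
  with assms show "coeff_wzq (scale_z b (FCFS_gf b)) (b * m) n k =
      coeff_wzq (of_nat b * integral_0_z (U_integrand b)) (b * m) n k"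
    by (rule coeff_FCFS_eq_integral_U)
next
  fix N n k assume N: "\<not> (\<exists>m. 1 \<le> m \<and> N = b * m \<and> b * m < n)"
  show "coeff_wzq (scale_z b (FCFS_gf b)) N n k =
      coeff_wzq (of_nat b * integral_0_z (U_integrand b)) N n k"
  proof (cases "\<exists>m. 1 \<le> m \<and> N = b * m")
    case True
    with N coeff_FCFS_eq_integral_U[OF assms] show ?thesis by (auto simp: not_less)
  next
    \<comment> \<open>If \<open>N\<close> is not a positive multiple of \<open>b\<close>, neither
      side has a term in \<open>w^N\<close>.\<close>
    case False
    then have empty: "{m. 1 \<le> m \<and> b * m = N} = {}" by auto
    have "fps_nth (U_gf b) N = 0" "fps_nth (FCFS_gf b) N = 0"
      by (simp_all only: U_gf_def FCFS_gf_def fps_nth_Abs_fps empty sum.empty)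
    have "map_fps fps_const (0 :: real fps fps) = 0"
      by (simp add: fps_eq_iff)
    with \<open>fps_nth (U_gf b) N = 0\<close> have "fps_nth (U_integrand b) N = 0"
      by (simp add: U_integrand_nth z_to_t_def scale_z_def)
    with \<open>fps_nth (FCFS_gf b) N = 0\<close> show ?thesis
      by (simp add: coeff_scale_z coeff_of_nat_mult coeff_integral_0_z) (simp add: coeff_wzq_def)
  qed
qed

end
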